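(* Let $f:\mathbb{R}^m\to\mathbb{R}$ be a non-negative Riemann integrable function satisfying $\int_{\mathbb{R}^m}f(\bm z)\,d\bm z=1$. Then for any given $\delta>0$ and $q\ge1$ there exists a Gaussian mixture density function $$p^*(\bm z)=\sum_{i=1}^K\pi_i\,p(\bm z|\bm\mu_i,\Sigma_i),$$ where $\pi_i>0$ and $\frac{\lambda_1(\Sigma_i)}{\lambda_m(\Sigma_i)}\le q$ for $i=1,\dots,K$, such that $$\int_{\mathbb{R}^m}|f(\bm z)-p^*(\bm z)|\,d\bm z<\delta .$$
   Context: $p(\cdot|\bm\mu,\Sigma)$ denotes the Gaussian density on $\mathbb{R}^m$ with mean $\bm\mu$ and non-singular covariance matrix $\Sigma$. A Gaussian mixture density function is a function $\sum_{i=1}^K\pi_ip(\cdot|\bm\mu_i,\Sigma_i)$ with $K$ a positive integer, $\pi_i>0$ and $\sum_{i=1}^K\pi_i=1$. For a covariance matrix $\Sigma$, $\lambda_1(\Sigma)$ and $\lambda_m(\Sigma)$ are its largest and smallest eigenvalues, so $\lambda_1(\Sigma)/\lambda_m(\Sigma)$ is its condition number. Riemann integrability on $\mathbb{R}^m$ is meant in the improper sense (Riemann integrable on bounded boxes, with convergent integral over $\mathbb{R}^m$). *)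

theory Defs
  imports "HOL-Analysis.Analysis"
begin

(* Unlike has_integral, which lets the gauge vary with the tag, the mesh here is bounded by one
   constant, so this is the Riemann integral and not the Henstock-Kurzweil one. *)
definition has_Riemann_integral_box ::
    "('a::euclidean_space \<Rightarrow> real) \<Rightarrow> real \<Rightarrow> 'a \<Rightarrow> 'a \<Rightarrow> bool" where
  "has_Riemann_integral_box f I a b \<longleftrightarrow>
     (\<forall>e>0. \<exists>d>0. \<forall>p. p tagged_division_of cbox a b \<and> (\<forall>(x, k)\<in>p. diameter k < d) \<longrightarrow>
        \<bar>(\<Sum>(x, k)\<in>p. measure lborel k * f x) - I\<bar> < e)"

definition has_improper_Riemann_integral ::
    "('a::euclidean_space \<Rightarrow> real) \<Rightarrow> real \<Rightarrow> bool" where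
  "has_improper_Riemann_integral f I \<longleftrightarrow>
     (\<forall>a b. \<exists>J. has_Riemann_integral_box f J a b) \<and>
     (\<forall>e>0. \<exists>B>0. \<forall>a b. ball 0 B \<subseteq> cbox a b \<longrightarrow>
        (\<exists>J. has_Riemann_integral_box f J a b \<and> \<bar>J - I\<bar> < e))"

definition covariance_matrix :: "real^'m^'m \<Rightarrow> bool" where
  "covariance_matrix S \<longleftrightarrow> transpose S = S \<and> (\<forall>x. 0 \<le> x \<bullet> (S *v x))"

definition eigenvalues :: "real^'m^'m \<Rightarrow> real set" where
  "eigenvalues A = {c. \<exists>v. v \<noteq> 0 \<and> A *v v = c *\<^sub>R v}"

(* Only applied to symmetric matrices, for which eigenvalues is finite and nonempty. *)
definition max_eigenvalue :: "real^'m^'m \<Rightarrow> real" where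
  "max_eigenvalue A = Max (eigenvalues A)"

definition min_eigenvalue :: "real^'m^'m \<Rightarrow> real" where
  "min_eigenvalue A = Min (eigenvalues A)"

definition gaussian_density :: "real^'m \<Rightarrow> real^'m^'m \<Rightarrow> real^'m \<Rightarrow> real" where
  "gaussian_density \<mu> S z =
     exp (- ((z - \<mu>) \<bullet> (matrix_inv S *v (z - \<mu>))) / 2) / sqrt ((2 * pi) ^ CARD('m) * det S)"

definition gaussian_mixture ::
    "nat \<Rightarrow> (nat \<Rightarrow> real) \<Rightarrow> (nat \<Rightarrow> real^'m) \<Rightarrow> (nat \<Rightarrow> real^'m^'m) \<Rightarrow> real^'m \<Rightarrow> real" where
  "gaussian_mixture K w \<mu> S z = (\<Sum>i=1..K. w i * gaussian_density (\<mu> i) (S i) z)"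

definition mixture_parameters ::
    "nat \<Rightarrow> (nat \<Rightarrow> real) \<Rightarrow> (nat \<Rightarrow> real^'m^'m) \<Rightarrow> bool" where
  "mixture_parameters K w S \<longleftrightarrow>
     K \<ge> 1 \<and> (\<forall>i\<in>{1..K}. w i > 0) \<and> (\<Sum>i=1..K. w i) = 1 \<and>
     (\<forall>i\<in>{1..K}. covariance_matrix (S i) \<and> invertible (S i))"

end

theory Submission
  imports Defs "HOL-Probability.Distributions"
begin

text \<open>Isotropic Gaussians \<open>\<Sigma> = \<sigma>\<^sup>2 I\<close> have condition number 1, so they suffice for
  every \<open>q\<close>. Riemann integrability means that the total oscillation of \<open>f\<close> over fine divisions is
  small; hence \<open>f\<close> is close in the mean to a non-negative step function. The indicator of a box is
  the limit, off the boundary, of its convolutions with Gaussians of vanishing variance, and these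
  are uniformly approximated by their Riemann sums, which are combinations of Gaussians.
  Normalising the resulting combination changes it by no more than the error already made.
  The oscillation criterion also shows that \<open>\<bar>f - p*\<bar>\<close> is Riemann integrable.\<close>

text \<open>The hypothesis speaks of limits of sums, a form in which neither absolute values nor
  distances to step functions can be estimated directly. Summed differences
  \<open>|f x - f y|\<close> over the pieces survive both operations, and they lead back to Riemann
  integrability once absolute integrability supplies the value of the integral. Non-negativity of
  \<open>f\<close> enters twice: it makes the improper integral absolutely convergent, so that
  Lebesgue integration is available, and it makes the values of \<open>f\<close> admissible weights.
  A Riemann integrable function is Lebesgue measurable but may fail to be Borel, so integrals
  involving \<open>f\<close> are taken over \<open>lebesgue\<close> and those of Gaussians alone
  over \<open>lborel\<close>. The Gaussian sums carry exactly the mass of the box that they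
  approximate; this equality, rather than an estimate of Gaussian tails, yields convergence in the
  mean.\<close>

hide_const (open) Polynomial.content

section \<open>Oscillation criterion for the Riemann integral\<close>

text \<open>Spreads an error budget \<open>r\<close> over a total weight \<open>c\<close> that may
  be zero, such as the volume of a degenerate box; hence the \<open>+ 1\<close> in the
  denominator.\<close>

lemma mult_divide_add_one_less:
  fixes c r :: real
  assumes "0 \<le> c" "0 < r"
  shows "0 < r / (c + 1)" "c * (r / (c + 1)) < r"
  using assms by (auto simp: field_simps add_nonneg_pos)

text \<open>A quantified second point \<open>y\<close> in each piece replaces the supremum and
  infimum of Darboux sums. The condition thus makes sense for unbounded \<open>f\<close> too, as can
  occur on a degenerate box, where every term has content zero.\<close>

definition small_oscillation :: "('a::euclidean_space \<Rightarrow> real) \<Rightarrow> 'a \<Rightarrow> 'a \<Rightarrow> bool" where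
  "small_oscillation f a b \<longleftrightarrow>
     (\<forall>e>0. \<exists>d>0. \<forall>p y. p tagged_division_of cbox a b \<longrightarrow>
        (\<forall>(x, k)\<in>p. diameter k < d \<and> y (x, k) \<in> k) \<longrightarrow>
        (\<Sum>(x, k)\<in>p. content k * \<bar>f x - f (y (x, k))\<bar>) < e)"

lemma small_oscillationE:
  assumes "small_oscillation f a b" "e > 0"
  obtains d where "d > 0" and "\<And>p y. p tagged_division_of cbox a b \<Longrightarrow>
      \<forall>(x, k)\<in>p. diameter k < d \<and> y (x, k) \<in> k \<Longrightarrow>
      (\<Sum>(x, k)\<in>p. content k * \<bar>f x - f (y (x, k))\<bar>) < e"
proof -
  obtain d where d: "d > 0 \<and> (\<forall>p y. p tagged_division_of cbox a b \<longrightarrow>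
      (\<forall>(x, k)\<in>p. diameter k < d \<and> y (x, k) \<in> k) \<longrightarrow>
      (\<Sum>(x, k)\<in>p. content k * \<bar>f x - f (y (x, k))\<bar>) < e)"
    using assms(1)[unfolded small_oscillation_def, THEN spec, THEN mp, OF assms(2)] by (rule exE)
  show thesis
  proof (rule that)
    show "d > 0"
      using d by (rule conjunct1)
  qed (use d[THEN conjunct2, THEN spec, THEN spec, THEN mp, THEN mp] in assumption)
qed

lemma has_Riemann_integral_boxE:
  assumes "has_Riemann_integral_box f J a b" "e > 0"
  obtains d where "d > 0" and "\<And>p. p tagged_division_of cbox a b \<Longrightarrow>
      \<forall>(x, k)\<in>p. diameter k < d \<Longrightarrow> \<bar>(\<Sum>(x, k)\<in>p. content k * f x) - J\<bar> < e"
proof -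
  obtain d where d: "d > 0 \<and> (\<forall>p. p tagged_division_of cbox a b \<and> (\<forall>(x, k)\<in>p. diameter k < d) \<longrightarrow>
      \<bar>(\<Sum>(x, k)\<in>p. content k * f x) - J\<bar> < e)"
    using assms(1)[unfolded has_Riemann_integral_box_def, THEN spec, THEN mp, OF assms(2)] by (rule exE)
  show thesis
  proof (rule that)
    show "d > 0"
      using d by (rule conjunct1)
  qed (use d[THEN conjunct2, THEN spec, THEN mp, OF conjI] in assumption)
qed

lemma tagged_division_retag:
  assumes p: "p tagged_division_of S" and y: "\<forall>(x, k)\<in>p. y (x, k) \<in> k"
  shows "(\<lambda>(x, k). (y (x, k), k)) ` p tagged_division_of S"
proof -
  note p' = p[unfolded tagged_division_of]
  show ?thesis
    unfolding tagged_division_of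
  proof (intro conjI allI impI)
    show "finite ((\<lambda>(x, k). (y (x, k), k)) ` p)"
      using p' by blast
  next
    fix x K assume "(x, K) \<in> (\<lambda>(x, k). (y (x, k), k)) ` p"
    then show "x \<in> K" "K \<subseteq> S" "\<exists>a b. K = cbox a b"
      using p' y by auto
  next
    fix x1 K1 x2 K2
    assume "(x1, K1) \<in> (\<lambda>(x, k). (y (x, k), k)) ` p \<and> (x2, K2) \<in> (\<lambda>(x, k). (y (x, k), k)) ` p \<and>
        (x1, K1) \<noteq> (x2, K2)"
    then obtain u1 u2 where "(u1, K1) \<in> p" "(u2, K2) \<in> p" "(u1, K1) \<noteq> (u2, K2)"
      by auto
    then show "interior K1 \<inter> interior K2 = {}"
      using p' by blast
  next
    have "{K. \<exists>x. (x, K) \<in> (\<lambda>(x, k). (y (x, k), k)) ` p} = {K. \<exists>x. (x, K) \<in> p}"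
      by force
    then show "\<Union> {K. \<exists>x. (x, K) \<in> (\<lambda>(x, k). (y (x, k), k)) ` p} = S"
      using p' by simp
  qed
qed

text \<open>A division may contain one piece under two tags, and retagging may merge the two pairs.
  Such a piece has interior disjoint from itself, hence content zero, so the merging does not change
  the sum.\<close>

lemma Riemann_sum_retag:
  assumes p: "p tagged_division_of S"
  shows "(\<Sum>(x, k)\<in>(\<lambda>(x, k). (y (x, k), k)) ` p. content k * f x) =
         (\<Sum>(x, k)\<in>p. content k * (f (y (x, k)) :: real))"
proof -
  have "(\<Sum>(x, k)\<in>(\<lambda>(x, k). (y (x, k), k)) ` p. content k * f x) =
        sum ((\<lambda>(x, k). content k * f x) \<circ> (\<lambda>(x, k). (y (x, k), k))) p"
  proof (rule sum.reindex_nontrivial)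
    show "finite p"
      using p by blast
  next
    fix u v assume "u \<in> p" "v \<in> p" "u \<noteq> v" and
      eq: "(\<lambda>(x, k). (y (x, k), k)) u = (\<lambda>(x, k). (y (x, k), k)) v"
    obtain x1 x2 k where uv: "u = (x1, k)" "v = (x2, k)"
      using eq by (cases u, cases v) auto
    then have "interior k \<inter> interior k = {}" "\<exists>a b. k = cbox a b"
      using p \<open>u \<in> p\<close> \<open>v \<in> p\<close> \<open>u \<noteq> v\<close> unfolding tagged_division_of by blast+
    then have "content k = 0"
      by (metis content_eq_0_interior inf.idem)
    then show "(\<lambda>(x, k). content k * f x) ((\<lambda>(x, k). (y (x, k), k)) u) = 0"
      by (simp add: uv)
  qed
  also have "\<dots> = (\<Sum>(x, k)\<in>p. content k * f (y (x, k)))"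
    by (rule sum.cong) auto
  finally show ?thesis .
qed

text \<open>Translates fineness for a constant gauge into a mesh bound: a ball of radius
  \<open>d / 3\<close> has diameter \<open>2 * d / 3\<close>, strictly below
  \<open>d\<close>.\<close>

lemma diameter_less_of_subset_ball:
  fixes x :: "'a::euclidean_space"
  assumes "k \<subseteq> ball x (d / 3)" "d > 0"
  shows "diameter k < d"
proof -
  have "diameter k \<le> diameter (ball x (d / 3))"
    using assms(1) by (intro diameter_subset) auto
  then show ?thesis
    using assms(2) by simp
qed

lemma has_Riemann_integral_box_imp_has_integral:
  assumes "has_Riemann_integral_box f J a b"
  shows "(f has_integral J) (cbox a b)"
  unfolding has_integral
proof (intro allI impI)
  fix e :: real assume "e > 0"
  then obtain d where "d > 0" and d: "\<And>p. p tagged_division_of cbox a b \<Longrightarrow>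
      \<forall>(x, k)\<in>p. diameter k < d \<Longrightarrow> \<bar>(\<Sum>(x, k)\<in>p. content k * f x) - J\<bar> < e"
    using has_Riemann_integral_boxE[OF assms] by metis
  have "norm ((\<Sum>(x, k)\<in>p. content k *\<^sub>R f x) - J) < e"
    if p: "p tagged_division_of cbox a b" and fine: "(\<lambda>x. ball x (d / 3)) fine p" for p
  proof -
    have "diameter k < d" if "(x, k) \<in> p" for x k
      using fine that \<open>d > 0\<close> by (intro diameter_less_of_subset_ball) (auto simp: fine_def)
    then show ?thesis
      using d[OF p] by auto
  qed
  then show "\<exists>\<gamma>. gauge \<gamma> \<and> (\<forall>p. p tagged_division_of cbox a b \<and> \<gamma> fine p \<longrightarrow>
      norm ((\<Sum>(x, k)\<in>p. content k *\<^sub>R f x) - J) < e)"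
    using \<open>d > 0\<close> by (intro exI[of _ "\<lambda>x. ball x (d / 3)"]) auto
qed

lemma has_Riemann_integral_box_imp_small_oscillation:
  assumes "has_Riemann_integral_box f J a b"
  shows "small_oscillation f a b"
  unfolding small_oscillation_def
proof (intro allI impI)
  fix e :: real assume "e > 0"
  then have "e / 2 > 0"
    by simp
  then obtain d where "d > 0" and d: "\<And>p. p tagged_division_of cbox a b \<Longrightarrow>
      \<forall>(x, k)\<in>p. diameter k < d \<Longrightarrow> \<bar>(\<Sum>(x, k)\<in>p. content k * f x) - J\<bar> < e / 2"
    using has_Riemann_integral_boxE[OF assms] by metis
  have "(\<Sum>(x, k)\<in>p. content k * \<bar>f x - f (y (x, k))\<bar>) < e"
    if p: "p tagged_division_of cbox a b" and y: "\<forall>(x, k)\<in>p. diameter k < d \<and> y (x, k) \<in> k" for p y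
  proof -
    txt \<open>Two retaggings turn the sum of absolute values into a difference of Riemann sums.\<close>
    define hi where "hi = (\<lambda>(x, k). if f x \<ge> f (y (x, k)) then x else y (x, k))"
    define lo where "lo = (\<lambda>(x, k). if f x \<ge> f (y (x, k)) then y (x, k) else x)"
    have tag: "\<bar>(\<Sum>(x, k)\<in>p. content k * f (z (x, k))) - J\<bar> < e / 2"
      if z: "\<forall>(x, k)\<in>p. z (x, k) \<in> k" for z
    proof -
      have "\<forall>(x, k)\<in>(\<lambda>(x, k). (z (x, k), k)) ` p. diameter k < d"
        using y by auto
      then show ?thesis
        using d[OF tagged_division_retag[OF p z]] by (simp add: Riemann_sum_retag[OF p])
    qed
    have "\<forall>(x, k)\<in>p. hi (x, k) \<in> k" "\<forall>(x, k)\<in>p. lo (x, k) \<in> k"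
      using y tagged_division_ofD(2)[OF p] by (auto simp: hi_def lo_def)
    from this[THEN tag] have "(\<Sum>(x, k)\<in>p. content k * f (hi (x, k))) -
        (\<Sum>(x, k)\<in>p. content k * f (lo (x, k))) < e"
      by linarith
    moreover have "(\<Sum>(x, k)\<in>p. content k * \<bar>f x - f (y (x, k))\<bar>) =
        (\<Sum>(x, k)\<in>p. content k * f (hi (x, k))) - (\<Sum>(x, k)\<in>p. content k * f (lo (x, k)))"
      unfolding sum_subtractf[symmetric]
      by (rule sum.cong) (auto simp: hi_def lo_def algebra_simps)
    ultimately show ?thesis
      by simp
  qed
  then show "\<exists>d>0. \<forall>p y. p tagged_division_of cbox a b \<longrightarrow>
        (\<forall>(x, k)\<in>p. diameter k < d \<and> y (x, k) \<in> k) \<longrightarrow>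
        (\<Sum>(x, k)\<in>p. content k * \<bar>f x - f (y (x, k))\<bar>) < e"
    using \<open>d > 0\<close> by blast
qed

text \<open>In each piece, \<open>y\<close> is chosen so that \<open>f y\<close> deviates from \<open>f x\<close> by almost the mean deviation.\<close>

lemma oscillation_bounds_integral:
  fixes f :: "'a::euclidean_space \<Rightarrow> real"
  assumes f: "f absolutely_integrable_on cbox a b" and p: "p tagged_division_of cbox a b"
    and osc: "\<And>y. \<forall>(x, k)\<in>p. y (x, k) \<in> k \<Longrightarrow>
        (\<Sum>(x, k)\<in>p. content k * \<bar>f x - f (y (x, k))\<bar>) < e"
  shows "(\<Sum>(x, k)\<in>p. integral k (\<lambda>z. \<bar>f z - f x\<bar>)) \<le> e"
proof (rule field_le_epsilon)
  fix r :: real assume "r > 0"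
  \<comment> \<open>The largest deviation in a piece need not be attained, so each piece is allowed
    a slack of \<open>\<eta>\<close> per unit volume, less than \<open>r\<close> in total.\<close>
  define \<eta> where "\<eta> = r / (content (cbox a b) + 1)"
  have "\<eta> > 0"
    using mult_divide_add_one_less(1)[OF content_pos_le \<open>r > 0\<close>] by (simp add: \<eta>_def)
  have *: "\<exists>y\<in>k. integral k (\<lambda>z. \<bar>f z - f x\<bar>) \<le> content k * (\<bar>f x - f y\<bar> + \<eta>)" if xk: "(x, k) \<in> p" for x k
  proof (rule ccontr)
    assume *: "\<not> ?thesis"
    obtain c d where "k = cbox c d"
      using tagged_division_ofD(4)[OF p xk] by (elim exE)
    note k = this tagged_division_ofD(2,3)[OF p xk]
    let ?I = "integral k (\<lambda>z. \<bar>f z - f x\<bar>)"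
    have less: "content k * (\<bar>f x - f y\<bar> + \<eta>) < ?I" if "y \<in> k" for y
      using * that by force
    have "f absolutely_integrable_on k"
      using f k absolutely_integrable_on_subcbox by blast
    then have "(\<lambda>z. f z - f x) absolutely_integrable_on k"
      using k by (intro set_integral_diff) (auto intro: absolutely_integrable_on_const)
    then have int: "((\<lambda>z. \<bar>f z - f x\<bar>) has_integral ?I) (cbox c d)"
      unfolding absolutely_integrable_on_def real_norm_def k(1)[symmetric] by (intro integrable_integral) auto
    show False
    proof (cases "content k = 0")
      case True
      then show False
        using less[OF k(2)] k(1) by (simp add: integral_null)
    next
      case False
      then have pos: "content k > 0"
        using k(1) by (simp add: order_less_le)
      \<comment> \<open>\<open>B\<close> is the mean of \<open>|f z - f x|\<close> over the piece,
        lowered by \<open>\<eta>\<close>. If every point deviated by less than \<open>B\<close>, the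
        mean would be at most \<open>B\<close>, that is, below itself.\<close>
      define B where "B = ?I / content k - \<eta>"
      have B: "\<bar>f x - f y\<bar> < B" if "y \<in> k" for y
        using less[OF that] pos by (simp add: B_def field_simps)
      then have "0 \<le> B"
        using k(2) by force
      have "norm ?I \<le> B * content (cbox c d)"
        using B k(1) by (intro has_integral_bound[OF \<open>0 \<le> B\<close> int]) (force simp: abs_minus_commute)
      then have "?I \<le> B * content k"
        using k(1) by simp
      also have "\<dots> = ?I - \<eta> * content k"
        using pos by (simp add: B_def field_simps)
      also have "\<dots> < ?I"
        using pos \<open>\<eta> > 0\<close> by simp
      finally show False by simp
    qed
  qed
  then have "\<forall>u\<in>p. \<exists>y. y \<in> snd u \<and>
      integral (snd u) (\<lambda>z. \<bar>f z - f (fst u)\<bar>) \<le> content (snd u) * (\<bar>f (fst u) - f y\<bar> + \<eta>)"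
    by force
  then obtain y where y: "\<And>u. u \<in> p \<Longrightarrow> y u \<in> snd u \<and>
      integral (snd u) (\<lambda>z. \<bar>f z - f (fst u)\<bar>) \<le> content (snd u) * (\<bar>f (fst u) - f (y u)\<bar> + \<eta>)"
    by metis
  have "(\<Sum>(x, k)\<in>p. integral k (\<lambda>z. \<bar>f z - f x\<bar>)) \<le> (\<Sum>(x, k)\<in>p. content k * (\<bar>f x - f (y (x, k))\<bar> + \<eta>))"
    using y by (intro sum_mono) force
  also have "\<dots> = (\<Sum>(x, k)\<in>p. content k * \<bar>f x - f (y (x, k))\<bar>) + (\<Sum>(x, k)\<in>p. content k) * \<eta>"
    by (simp add: distrib_left sum.distrib case_prod_unfold sum_distrib_right)
  also have "(\<Sum>(x, k)\<in>p. content k) = content (cbox a b)"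
    using additive_content_tagged_division[OF p] .
  also have "content (cbox a b) * \<eta> \<le> r"
    unfolding \<eta>_def
    by (rule less_imp_le[OF mult_divide_add_one_less(2)[OF content_pos_le[of "cbox a b"] \<open>r > 0\<close>]])
  also have "(\<Sum>(x, k)\<in>p. content k * \<bar>f x - f (y (x, k))\<bar>) < e"
    using y by (intro osc) force
  finally show "(\<Sum>(x, k)\<in>p. integral k (\<lambda>z. \<bar>f z - f x\<bar>)) \<le> e + r"
    by simp
qed

text \<open>Absolute integrability provides the candidate value. On a piece with tag
  \<open>x\<close> the Riemann term misses the integral by at most the integral of
  \<open>|f z - f x|\<close>, and \<open>oscillation_bounds_integral\<close> controls the sum of
  these errors.\<close>

lemma small_oscillation_imp_has_Riemann_integral_box:
  fixes f :: "'a::euclidean_space \<Rightarrow> real"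
  assumes f: "f absolutely_integrable_on cbox a b" and osc: "small_oscillation f a b"
  shows "has_Riemann_integral_box f (integral (cbox a b) f) a b"
  unfolding has_Riemann_integral_box_def
proof (intro allI impI)
  fix e :: real assume "e > 0"
  \<comment> \<open>Half of \<open>e\<close>, because the bound on the integrals is not strict
    whereas the definition requires a strict one.\<close>
  obtain d where "d > 0" and d: "\<And>p y. p tagged_division_of cbox a b \<Longrightarrow>
      \<forall>(x, k)\<in>p. diameter k < d \<and> y (x, k) \<in> k \<Longrightarrow>
      (\<Sum>(x, k)\<in>p. content k * \<bar>f x - f (y (x, k))\<bar>) < e / 2"
    by (fact small_oscillationE[OF osc half_gt_zero[OF \<open>e > 0\<close>]])
  have "\<bar>(\<Sum>(x, k)\<in>p. content k * f x) - integral (cbox a b) f\<bar> < e"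
    if p: "p tagged_division_of cbox a b \<and> (\<forall>(x, k)\<in>p. diameter k < d)" for p
  proof -
    have bound: "\<bar>content k * f x - integral k f\<bar> \<le> integral k (\<lambda>z. \<bar>f z - f x\<bar>)" if xk: "(x, k) \<in> p" for x k
    proof -
      obtain c d where "k = cbox c d"
        using tagged_division_ofD(4)[OF conjunct1[OF p] xk] by (elim exE)
      note k = this tagged_division_ofD(3)[OF conjunct1[OF p] xk]
      have fk: "f absolutely_integrable_on k"
        using f k absolutely_integrable_on_subcbox by blast
      then have "(\<lambda>z. f z - f x) absolutely_integrable_on k"
        using k by (intro set_integral_diff) (auto intro: absolutely_integrable_on_const)
      then have "norm (integral k (\<lambda>z. f z - f x)) \<le> integral k (\<lambda>z. norm (f z - f x))"
        by (intro integral_norm_bound_integral) (auto simp: absolutely_integrable_on_def)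
      moreover have "integral k (\<lambda>z. f z - f x) = integral k f - content k * f x"
        using fk k by (subst integral_diff) (auto simp: set_lebesgue_integral_eq_integral(1))
      ultimately show ?thesis
        by (simp add: abs_minus_commute)
    qed
    have "integral (cbox a b) f = (\<Sum>(x, k)\<in>p. integral k f)"
      using f p by (intro integral_combine_tagged_division_topdown) (auto simp: set_lebesgue_integral_eq_integral(1))
    then have "\<bar>(\<Sum>(x, k)\<in>p. content k * f x) - integral (cbox a b) f\<bar> =
        \<bar>\<Sum>(x, k)\<in>p. content k * f x - integral k f\<bar>"
      by (simp add: sum_subtractf case_prod_unfold)
    also have "\<dots> \<le> (\<Sum>(x, k)\<in>p. \<bar>content k * f x - integral k f\<bar>)"
      by (simp add: case_prod_unfold sum_abs)
    also have "\<dots> \<le> (\<Sum>(x, k)\<in>p. integral k (\<lambda>z. \<bar>f z - f x\<bar>))"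
      using bound by (intro sum_mono) auto
    also have "\<dots> \<le> e / 2"
    proof (rule oscillation_bounds_integral[OF f])
      fix y assume "\<forall>(x, k)\<in>p. y (x, k) \<in> k"
      then show "(\<Sum>(x, k)\<in>p. content k * \<bar>f x - f (y (x, k))\<bar>) < e / 2"
        using p by (intro d) auto
    qed (use p \<open>e > 0\<close> in auto)
    finally show ?thesis
      using \<open>e > 0\<close> by simp
  qed
  then show "\<exists>d>0. \<forall>p. p tagged_division_of cbox a b \<and> (\<forall>(x, k)\<in>p. diameter k < d) \<longrightarrow>
      \<bar>(\<Sum>(x, k)\<in>p. content k * f x) - integral (cbox a b) f\<bar> < e"
    using \<open>d > 0\<close> by blast
qed

lemma continuous_imp_small_oscillation:
  assumes "continuous_on (cbox a b) g"
  shows "small_oscillation g a b"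
  unfolding small_oscillation_def
proof (intro allI impI)
  fix e :: real assume "e > 0"
  define r where "r = e / (content (cbox a b) + 1)"
  have "r > 0"
    using mult_divide_add_one_less(1)[OF content_pos_le \<open>e > 0\<close>] by (simp add: r_def)
  have "uniformly_continuous_on (cbox a b) g"
    using assms by (simp add: compact_uniformly_continuous)
  then obtain d where "d > 0" and d: "\<And>x y. x \<in> cbox a b \<Longrightarrow> y \<in> cbox a b \<Longrightarrow> dist y x < d \<Longrightarrow> dist (g y) (g x) < r"
    unfolding uniformly_continuous_on_def using \<open>r > 0\<close> by metis
  have "(\<Sum>(x, k)\<in>p. content k * \<bar>g x - g (y (x, k))\<bar>) < e"
    if p: "p tagged_division_of cbox a b" and y: "\<forall>(x, k)\<in>p. diameter k < d \<and> y (x, k) \<in> k" for p y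
  proof -
    have "\<bar>g x - g (y (x, k))\<bar> \<le> r" if xk: "(x, k) \<in> p" for x k
    proof -
      have k: "x \<in> k" "k \<subseteq> cbox a b" "y (x, k) \<in> k" "diameter k < d"
        using tagged_division_ofD(2-4)[OF p xk] y xk by auto
      moreover have "bounded k"
        using k(2) bounded_cbox bounded_subset by blast
      ultimately have "dist x (y (x, k)) < d"
        using diameter_bounded_bound by (metis order.strict_trans1)
      then show ?thesis
        using d[of "y (x, k)" x] subsetD[OF k(2) k(1)] subsetD[OF k(2) k(3)] by (simp add: dist_real_def)
    qed
    then have "(\<Sum>(x, k)\<in>p. content k * \<bar>g x - g (y (x, k))\<bar>) \<le> (\<Sum>(x, k)\<in>p. content k * r)"
      by (intro sum_mono) (auto intro: mult_left_mono)
    also have "\<dots> = content (cbox a b) * r"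
      using additive_content_tagged_division[OF p] by (simp add: case_prod_unfold flip: sum_distrib_right)
    also have "\<dots> < e"
      using mult_divide_add_one_less(2)[OF content_pos_le \<open>e > 0\<close>] by (simp add: r_def)
    finally show ?thesis .
  qed
  then show "\<exists>d>0. \<forall>p y. p tagged_division_of cbox a b \<longrightarrow>
        (\<forall>(x, k)\<in>p. diameter k < d \<and> y (x, k) \<in> k) \<longrightarrow>
        (\<Sum>(x, k)\<in>p. content k * \<bar>g x - g (y (x, k))\<bar>) < e"
    using \<open>d > 0\<close> by blast
qed

text \<open>By the reverse triangle inequality the oscillation of \<open>|f - g|\<close> is at most
  the sum of the two oscillations. This is how integrability of the approximation error is
  obtained.\<close>

lemma small_oscillation_abs_diff:
  assumes "small_oscillation f a b" "small_oscillation g a b"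
  shows "small_oscillation (\<lambda>x. \<bar>f x - g x\<bar>) a b"
  unfolding small_oscillation_def
proof (intro allI impI)
  fix e :: real assume "e > 0"
  obtain d1 where "d1 > 0" and d1: "\<And>p y. p tagged_division_of cbox a b \<Longrightarrow>
      \<forall>(x, k)\<in>p. diameter k < d1 \<and> y (x, k) \<in> k \<Longrightarrow>
      (\<Sum>(x, k)\<in>p. content k * \<bar>f x - f (y (x, k))\<bar>) < e / 2"
    by (fact small_oscillationE[OF assms(1) half_gt_zero[OF \<open>e > 0\<close>]])
  obtain d2 where "d2 > 0" and d2: "\<And>p y. p tagged_division_of cbox a b \<Longrightarrow>
      \<forall>(x, k)\<in>p. diameter k < d2 \<and> y (x, k) \<in> k \<Longrightarrow>
      (\<Sum>(x, k)\<in>p. content k * \<bar>g x - g (y (x, k))\<bar>) < e / 2"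
    by (fact small_oscillationE[OF assms(2) half_gt_zero[OF \<open>e > 0\<close>]])
  have "(\<Sum>(x, k)\<in>p. content k * \<bar>\<bar>f x - g x\<bar> - \<bar>f (y (x, k)) - g (y (x, k))\<bar>\<bar>) < e"
    if p: "p tagged_division_of cbox a b" and y: "\<forall>(x, k)\<in>p. diameter k < min d1 d2 \<and> y (x, k) \<in> k" for p y
  proof -
    have "(\<Sum>(x, k)\<in>p. content k * \<bar>\<bar>f x - g x\<bar> - \<bar>f (y (x, k)) - g (y (x, k))\<bar>\<bar>) \<le>
        (\<Sum>(x, k)\<in>p. content k * \<bar>f x - f (y (x, k))\<bar> + content k * \<bar>g x - g (y (x, k))\<bar>)"
      unfolding distrib_left[symmetric]
      by (intro sum_mono) (auto intro!: mult_left_mono)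
    also have "\<dots> = (\<Sum>(x, k)\<in>p. content k * \<bar>f x - f (y (x, k))\<bar>) +
        (\<Sum>(x, k)\<in>p. content k * \<bar>g x - g (y (x, k))\<bar>)"
      by (simp add: case_prod_unfold sum.distrib)
    also have "\<dots> < e / 2 + e / 2"
      using y by (intro add_strict_mono d1[OF p] d2[OF p]) auto
    finally show ?thesis
      by simp
  qed
  moreover have "min d1 d2 > 0"
    using \<open>d1 > 0\<close> \<open>d2 > 0\<close> by simp
  ultimately show "\<exists>d>0. \<forall>p y. p tagged_division_of cbox a b \<longrightarrow>
        (\<forall>(x, k)\<in>p. diameter k < d \<and> y (x, k) \<in> k) \<longrightarrow>
        (\<Sum>(x, k)\<in>p. content k * \<bar>\<bar>f x - g x\<bar> - \<bar>f (y (x, k)) - g (y (x, k))\<bar>\<bar>) < e"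
    by blast
qed

section \<open>From boxes to the whole space\<close>

lemma has_improper_Riemann_integral_imp_has_integral:
  fixes f :: "'a::euclidean_space \<Rightarrow> real"
  assumes "has_improper_Riemann_integral f I"
  shows "(f has_integral I) UNIV"
  unfolding has_integral_alt'
proof (intro conjI allI impI)
  fix a b
  obtain J where "has_Riemann_integral_box f J a b"
    using assms[unfolded has_improper_Riemann_integral_def, THEN conjunct1, THEN spec, THEN spec] by (rule exE)
  then show "(\<lambda>x. if x \<in> UNIV then f x else 0) integrable_on cbox a b"
    using has_Riemann_integral_box_imp_has_integral[of f J a b] by (auto simp: integrable_on_def)
next
  fix e :: real assume "e > 0"
  obtain B where "B > 0" and B: "\<forall>a b. ball 0 B \<subseteq> cbox a b \<longrightarrow>
      (\<exists>J. has_Riemann_integral_box f J a b \<and> \<bar>J - I\<bar> < e)"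
    using assms[unfolded has_improper_Riemann_integral_def, THEN conjunct2, THEN spec, THEN mp, OF \<open>e > 0\<close>]
    by (elim exE conjE)
  show "\<exists>B>0. \<forall>a b. ball 0 B \<subseteq> cbox a b \<longrightarrow>
      norm (integral (cbox a b) (\<lambda>x. if x \<in> UNIV then f x else 0) - I) < e"
  proof (intro exI[of _ B] conjI allI impI \<open>B > 0\<close>)
    fix a b :: 'a assume "ball 0 B \<subseteq> cbox a b"
    then obtain J where "has_Riemann_integral_box f J a b" "\<bar>J - I\<bar> < e"
      using B by blast
    then show "norm (integral (cbox a b) (\<lambda>x. if x \<in> UNIV then f x else 0) - I) < e"
      using integral_unique[OF has_Riemann_integral_box_imp_has_integral[of f J a b]] by simp
  qed
qed

text \<open>The two requirements have separate sources: oscillation gives a Riemann integral on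
  every box, and \<open>has_integral_alt'\<close> gives convergence of the box integrals, which are
  the same numbers.\<close>

lemma has_improper_Riemann_integralI:
  fixes f :: "'a::euclidean_space \<Rightarrow> real"
  assumes int: "(f has_integral I) UNIV" and "f absolutely_integrable_on UNIV"
    and osc: "\<And>a b. small_oscillation f a b"
  shows "has_improper_Riemann_integral f I"
proof -
  have R: "has_Riemann_integral_box f (integral (cbox a b) f) a b" for a b
    using assms(2) by (intro small_oscillation_imp_has_Riemann_integral_box osc)
      (rule absolutely_integrable_on_subcbox, auto)
  show ?thesis
    unfolding has_improper_Riemann_integral_def
  proof (intro conjI allI impI)
    show "\<exists>J. has_Riemann_integral_box f J a b" for a b
      using R by blast
  next
    fix e :: real assume "e > 0"
    then obtain B where "B > 0" "\<And>a b. ball 0 B \<subseteq> cbox a b \<Longrightarrow> \<bar>integral (cbox a b) f - I\<bar> < e"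
      using int unfolding has_integral_alt' by auto
    then show "\<exists>B>0. \<forall>a b. ball 0 B \<subseteq> cbox a b \<longrightarrow> (\<exists>J. has_Riemann_integral_box f J a b \<and> \<bar>J - I\<bar> < e)"
      using R by blast
  qed
qed

section \<open>Isotropic Gaussians\<close>

lemma mat_mult_vec: "mat c *v x = c *\<^sub>R (x :: real^'m)"
  by (simp add: vec_eq_iff matrix_vector_mult_def mat_def if_distrib if_distribR cong: if_cong)

lemma mat_mult_mat: "mat c ** mat d = (mat (c * d) :: real^'m^'m)"
  by (simp add: matrix_eq mat_mult_vec flip: matrix_vector_mul_assoc)

lemma invertible_mat: "c \<noteq> 0 \<Longrightarrow> invertible (mat c :: real^'m^'m)"
  unfolding invertible_def by (intro exI[of _ "mat (inverse c)"]) (simp add: mat_mult_mat)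

lemma matrix_inv_mat:
  assumes "c \<noteq> 0"
  shows "matrix_inv (mat c :: real^'m^'m) = mat (inverse c)"
proof -
  have "\<exists>B :: real^'m^'m. mat c ** B = mat 1 \<and> B ** mat c = mat 1"
    using invertible_mat[OF assms] by (simp add: invertible_def)
  \<comment> \<open>\<open>matrix_inv\<close> is a Hilbert choice, known only through its defining
    property; cancelling with the explicit inverse determines its value.\<close>
  from someI_ex[OF this] have "mat c ** matrix_inv (mat c) = (mat 1 :: real^'m^'m)"
    by (simp add: matrix_inv_def)
  then have "mat (inverse c) ** (mat c ** matrix_inv (mat c)) = (mat (inverse c) ** mat 1 :: real^'m^'m)"
    by simp
  then show ?thesis
    using assms by (simp add: matrix_mul_assoc mat_mult_mat)
qed

lemma det_mat: "det (mat c :: real^'m^'m) = c ^ CARD('m)"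
  by (subst det_diagonal) (simp_all add: mat_def)

lemma covariance_matrix_mat: "0 \<le> c \<Longrightarrow> covariance_matrix (mat c :: real^'m^'m)"
  by (simp add: covariance_matrix_def transpose_mat mat_mult_vec)

text \<open>Maximum and minimum over this singleton coincide, so the quotient of the extreme
  eigenvalues is 1 for every nonzero scalar matrix.\<close>

lemma eigenvalues_mat: "eigenvalues (mat c :: real^'m^'m) = {c}"
proof -
  have "\<exists>v :: real^'m. v \<noteq> 0"
    by (intro exI[of _ "axis undefined 1"]) simp
  then show ?thesis
    by (auto simp: eigenvalues_def mat_mult_vec)
qed

text \<open>The product form reduces measurability and total mass to one dimension; the radial form
  in \<open>std_gaussian_eq\<close> serves scaling and the Lipschitz estimate.\<close>

definition std_gaussian :: "real^'m \<Rightarrow> real" where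
  "std_gaussian u = (\<Prod>b\<in>Basis. std_normal_density (u \<bullet> b))"

lemma std_gaussian_eq: "std_gaussian (u :: real^'m) = exp (- (norm u)\<^sup>2 / 2) / sqrt (2 * pi) ^ CARD('m)"
proof -
  have "std_gaussian u = (\<Prod>b\<in>(Basis :: (real^'m) set). 1 / sqrt (2 * pi)) * exp (\<Sum>b\<in>Basis. - (u \<bullet> b)\<^sup>2 / 2)"
    by (simp add: std_gaussian_def std_normal_density_def prod_dividef power_one_over exp_sum)
  also have "(\<Sum>b\<in>Basis. - (u \<bullet> b)\<^sup>2 / 2) = - (norm u)\<^sup>2 / 2"
    unfolding power2_norm_eq_inner euclidean_inner[of u u]
    by (simp add: power2_eq_square sum_negf sum_divide_distrib)
  finally show ?thesis
    by (simp add: power_divide)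
qed

lemma std_gaussian_nonneg: "0 \<le> std_gaussian u"
  by (simp add: std_gaussian_eq)

lemma borel_measurable_std_gaussian [measurable]: "std_gaussian \<in> borel_measurable borel"
  unfolding std_gaussian_def by measurable

lemma nn_integral_std_gaussian: "(\<integral>\<^sup>+u. std_gaussian (u :: real^'m) \<partial>lborel) = 1"
proof -
  have "(\<integral>\<^sup>+x. std_normal_density x \<partial>lborel) = 1"
    using nn_integral_eq_integral[OF integrable_normal_density, of 1 0] integral_normal_density[of 1 0] by simp
  moreover have "(\<integral>\<^sup>+u. (\<Prod>b\<in>Basis. ennreal (std_normal_density (u \<bullet> b))) \<partial>(lborel :: (real^'m) measure)) =
      (\<Prod>b\<in>(Basis :: (real^'m) set). \<integral>\<^sup>+x. std_normal_density x \<partial>lborel)"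
    by (rule nn_integral_lborel_prod) auto
  ultimately show ?thesis
    by (simp add: std_gaussian_def prod_ennreal)
qed

lemma integrable_std_gaussian: "integrable lborel (std_gaussian :: real^'m \<Rightarrow> real)"
  by (intro integrableI_nonneg) (auto simp: std_gaussian_nonneg nn_integral_std_gaussian)

lemma integral_std_gaussian: "(\<integral>u. std_gaussian (u :: real^'m) \<partial>lborel) = 1"
  by (intro integral_eq_nn_integral[THEN trans]) (auto simp: std_gaussian_nonneg nn_integral_std_gaussian)

text \<open>Applied with \<open>c = s\<close> to standardise a Gaussian in its argument and with
  \<open>c = - s\<close> to substitute in its mean; hence the absolute value.\<close>

lemma integral_lborel_affine:
  fixes F :: "'a::euclidean_space \<Rightarrow> real"
  assumes [measurable]: "F \<in> borel_measurable borel" and "c \<noteq> 0"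
  shows "(\<integral>y. F y \<partial>lborel) = \<bar>c\<bar> ^ DIM('a) * (\<integral>u. F (t + c *\<^sub>R u) \<partial>lborel)"
    and "integrable lborel F \<longleftrightarrow> integrable lborel (\<lambda>u. F (t + c *\<^sub>R u))"
proof -
  note eq = lborel_affine[OF \<open>c \<noteq> 0\<close>, of t]
  show "(\<integral>y. F y \<partial>lborel) = \<bar>c\<bar> ^ DIM('a) * (\<integral>u. F (t + c *\<^sub>R u) \<partial>lborel)"
    by (subst eq) (simp add: integral_density integral_distr)
  show "integrable lborel F \<longleftrightarrow> integrable lborel (\<lambda>u. F (t + c *\<^sub>R u))"
    using \<open>c \<noteq> 0\<close> by (subst eq) (simp add: integrable_density integrable_distr_eq)
qed

abbreviation iso_gaussian :: "real \<Rightarrow> real^'m \<Rightarrow> real^'m \<Rightarrow> real" where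
  "iso_gaussian s \<mu> \<equiv> gaussian_density \<mu> (mat (s\<^sup>2))"

lemma iso_gaussian_eq:
  assumes "s > 0"
  shows "iso_gaussian s \<mu> (z :: real^'m) = std_gaussian ((z - \<mu>) /\<^sub>R s) / s ^ CARD('m)"
proof -
  have "sqrt ((2 * pi) ^ CARD('m) * (s\<^sup>2) ^ CARD('m)) = sqrt (2 * pi) ^ CARD('m) * s ^ CARD('m)"
    using assms by (simp add: real_sqrt_mult real_sqrt_power power_mult_distrib)
  moreover have "(z - \<mu>) \<bullet> (inverse (s\<^sup>2) *\<^sub>R (z - \<mu>)) = (norm ((z - \<mu>) /\<^sub>R s))\<^sup>2"
    unfolding power2_norm_eq_inner using assms by (simp add: power2_eq_square)
  ultimately show ?thesis
    using assms by (simp add: gaussian_density_def std_gaussian_eq matrix_inv_mat det_mat mat_mult_vec)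
qed

lemma iso_gaussian_nonneg: "0 < s \<Longrightarrow> 0 \<le> iso_gaussian s \<mu> z"
  by (simp add: iso_gaussian_eq std_gaussian_nonneg)

lemma continuous_iso_gaussian: "continuous_on A (iso_gaussian s (\<mu> :: real^'m))"
  unfolding gaussian_density_def[abs_def] divide_inverse
  by (intro continuous_intros bounded_linear.continuous_on[OF matrix_vector_mul_bounded_linear])

lemma borel_measurable_iso_gaussian [measurable]: "iso_gaussian s (\<mu> :: real^'m) \<in> borel_measurable borel"
  by (rule borel_measurable_continuous_onI[OF continuous_iso_gaussian])

lemma
  assumes "s > 0"
  shows integrable_iso_gaussian: "integrable lborel (iso_gaussian s (\<mu> :: real^'m))"
    and integral_iso_gaussian: "(\<integral>z. iso_gaussian s (\<mu> :: real^'m) z \<partial>lborel) = 1"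
proof -
  have eq: "iso_gaussian s \<mu> (\<mu> + s *\<^sub>R u) = std_gaussian u / s ^ CARD('m)" for u
    using assms by (simp add: iso_gaussian_eq)
  show "integrable lborel (iso_gaussian s (\<mu> :: real^'m))"
    using assms by (subst integral_lborel_affine(2)[where t = \<mu> and c = s]) (auto simp: eq integrable_std_gaussian)
  show "(\<integral>z. iso_gaussian s (\<mu> :: real^'m) z \<partial>lborel) = 1"
    using assms by (subst integral_lborel_affine(1)[where t = \<mu> and c = s]) (auto simp: eq integral_std_gaussian)
qed

text \<open>The derivative has modulus \<open>|x| * exp (- x^2 / 2)\<close>, which is at most 1
  because \<open>|x| <= 1 + x^2 / 2 <= exp (x^2 / 2)\<close>.\<close>

lemma exp_neg_half_square_Lipschitz: "\<bar>exp (- s\<^sup>2 / 2) - exp (- t\<^sup>2 / 2)\<bar> \<le> \<bar>s - (t::real)\<bar>"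
proof -
  have "norm (exp (- s\<^sup>2 / 2) - exp (- t\<^sup>2 / 2)) \<le> 1 * norm (s - t)"
  proof (rule field_differentiable_bound[where S = UNIV and f' = "\<lambda>x. - x * exp (- x\<^sup>2 / 2)"])
    fix x :: real
    show "((\<lambda>x. exp (- x\<^sup>2 / 2)) has_field_derivative - x * exp (- x\<^sup>2 / 2)) (at x within UNIV)"
      by (auto intro!: derivative_eq_intros)
    have "0 \<le> (\<bar>x\<bar> - 1)\<^sup>2"
      by simp
    then have "\<bar>x\<bar> \<le> 1 + x\<^sup>2 / 2"
      by (simp add: power2_diff)
    also have "\<dots> \<le> exp (x\<^sup>2 / 2)"
      by (rule exp_ge_add_one_self)
    finally show "norm (- x * exp (- x\<^sup>2 / 2)) \<le> 1"
      by (simp add: abs_mult exp_minus field_simps)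
  qed auto
  then show ?thesis
    by simp
qed

text \<open>The constant does not depend on \<open>z\<close>, which makes Riemann sums over the mean
  converge uniformly in \<open>z\<close>. It is the normalising factor of the density times
  \<open>1 / s\<close>, the latter from rescaling the argument.\<close>

lemma iso_gaussian_Lipschitz:
  assumes "s > 0"
  shows "\<exists>L>0. \<forall>\<mu> \<nu> z. \<bar>iso_gaussian s \<mu> z - iso_gaussian s \<nu> (z :: real^'m)\<bar> \<le> L * dist \<mu> \<nu>"
proof (intro exI[of _ "1 / (sqrt (2 * pi) ^ CARD('m) * s ^ CARD('m) * s)"] conjI allI)
  let ?C = "sqrt (2 * pi) ^ CARD('m) * s ^ CARD('m)"
  have C: "?C > 0"
    using assms by simp
  show "0 < 1 / (?C * s)"
    using C assms by simp
  fix \<mu> \<nu> z :: "real^'m"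
  have "\<bar>iso_gaussian s \<mu> z - iso_gaussian s \<nu> z\<bar> =
      \<bar>exp (- (norm ((z - \<mu>) /\<^sub>R s))\<^sup>2 / 2) - exp (- (norm ((z - \<nu>) /\<^sub>R s))\<^sup>2 / 2)\<bar> / ?C"
    using assms C by (simp add: iso_gaussian_eq std_gaussian_eq abs_divide flip: diff_divide_distrib)
  also have "\<dots> \<le> norm ((z - \<mu>) /\<^sub>R s - (z - \<nu>) /\<^sub>R s) / ?C"
    using C exp_neg_half_square_Lipschitz norm_triangle_ineq3 by (intro divide_right_mono) (blast intro: order_trans, simp)
  also have "\<dots> = 1 / (?C * s) * dist \<mu> \<nu>"
    using assms by (simp add: dist_norm norm_minus_commute divide_simps flip: scaleR_diff_right)
  finally show "\<bar>iso_gaussian s \<mu> z - iso_gaussian s \<nu> z\<bar> \<le> 1 / (?C * s) * dist \<mu> \<nu>" .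
qed

text \<open>Substituting \<open>\<mu> = z - s u\<close> moves the dependence on \<open>s\<close>
  from the Gaussian into the indicator, leaving a fixed integrable weight.\<close>

lemma integral_indicator_iso_gaussian:
  assumes [measurable]: "A \<in> sets borel" and "s > 0"
  shows "(\<integral>\<mu>. indicator A \<mu> * iso_gaussian s \<mu> (z :: real^'m) \<partial>lborel) =
         (\<integral>u. indicator A (z - s *\<^sub>R u) * std_gaussian u \<partial>lborel)"
proof -
  have eq: "iso_gaussian s \<mu> z = std_gaussian ((z - \<mu>) /\<^sub>R s) / s ^ CARD('m)" for \<mu>
    using assms(2) by (rule iso_gaussian_eq)
  have "(\<integral>\<mu>. indicator A \<mu> * (std_gaussian ((z - \<mu>) /\<^sub>R s) / s ^ CARD('m)) \<partial>lborel) =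
      (\<integral>u. indicator A (z - s *\<^sub>R u) * std_gaussian u \<partial>lborel)"
    using assms(2) by (subst integral_lborel_affine(1)[where t = z and c = "- s"]) auto
  then show ?thesis
    by (simp add: eq)
qed

text \<open>Off the frontier the indicator is continuous at \<open>z\<close>, so the substituted
  integrand converges for each \<open>u\<close>, dominated by \<open>std_gaussian\<close>.\<close>

lemma tendsto_indicator_convolution:
  fixes z :: "real^'m"
  assumes A: "A \<in> sets borel" and z: "z \<notin> frontier A"
    and s: "s \<longlonglongrightarrow> 0" "\<And>n. s n > 0"
  shows "(\<lambda>n. \<integral>\<mu>. indicator A \<mu> * iso_gaussian (s n) \<mu> z \<partial>lborel) \<longlonglongrightarrow> indicator A z"
proof -
  have [measurable]: "A \<in> sets borel"
    by (rule A)
  have "(\<lambda>n. \<integral>u. indicator A (z - s n *\<^sub>R u) * std_gaussian u \<partial>lborel) \<longlonglongrightarrow>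
      (\<integral>u. indicator A z * std_gaussian (u :: real^'m) \<partial>lborel)"
  proof (rule integral_dominated_convergence[where w = std_gaussian])
    show "integrable lborel (std_gaussian :: real^'m \<Rightarrow> real)"
      by (rule integrable_std_gaussian)
    show "AE u in lborel. (\<lambda>n. indicator A (z - s n *\<^sub>R u) * std_gaussian u) \<longlonglongrightarrow> indicator A z * std_gaussian u"
    proof (intro AE_I2 tendsto_mult tendsto_const)
      fix u
      have "(\<lambda>n. z - s n *\<^sub>R u) \<longlonglongrightarrow> z - 0 *\<^sub>R u"
        by (intro tendsto_intros s)
      then have lim: "(\<lambda>n. z - s n *\<^sub>R u) \<longlonglongrightarrow> z"
        by simp
      have "isCont (indicator A :: _ \<Rightarrow> real) z"
        using z by (simp add: isCont_indicator)
      then show "(\<lambda>n. indicator A (z - s n *\<^sub>R u) :: real) \<longlonglongrightarrow> indicator A z"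
        using lim by (rule isCont_tendsto_compose)
    qed
    show "AE u in lborel. norm (indicator A (z - s n *\<^sub>R u) * std_gaussian u) \<le> std_gaussian u" for n
      by (auto simp: indicator_def std_gaussian_nonneg)
  qed auto
  then show ?thesis
    using s(2) A by (simp add: integral_indicator_iso_gaussian integral_std_gaussian)
qed

section \<open>Positive combinations of isotropic Gaussians\<close>

inductive gaussian_cone :: "(real^'m \<Rightarrow> real) \<Rightarrow> bool" where
  zero: "gaussian_cone (\<lambda>z. 0)"
| add: "gaussian_cone h \<Longrightarrow> w > 0 \<Longrightarrow> s > 0 \<Longrightarrow> gaussian_cone (\<lambda>z. h z + w * iso_gaussian s \<mu> z)"

lemma gaussian_cone_plus:
  assumes "gaussian_cone g" "gaussian_cone h"
  shows "gaussian_cone (\<lambda>z. g z + h z)"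
  using assms(2)
proof induction
  case zero
  then show ?case
    using assms(1) by simp
next
  case (add h w s \<mu>)
  then show ?case
    using gaussian_cone.add[of "\<lambda>z. g z + h z" w s \<mu>] by (simp add: add.assoc)
qed

lemma gaussian_cone_mult:
  assumes "gaussian_cone h" "c \<ge> 0"
  shows "gaussian_cone (\<lambda>z. c * h z)"
proof (cases "c = 0")
  case True
  then show ?thesis
    by (simp add: gaussian_cone.zero)
next
  case False
  show ?thesis
    using assms(1)
  proof induction
    case zero
    then show ?case
      by (simp add: gaussian_cone.zero)
  next
    case (add h w s \<mu>)
    then show ?case
      using False \<open>c \<ge> 0\<close> gaussian_cone.add[of "\<lambda>z. c * h z" "c * w" s \<mu>]
      by (simp add: distrib_left mult.assoc)
  qed
qed

lemma gaussian_cone_sum: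
  assumes "finite I" "\<And>i. i \<in> I \<Longrightarrow> gaussian_cone (g i)"
  shows "gaussian_cone (\<lambda>z. \<Sum>i\<in>I. g i z)"
  using assms by (induction I) (auto simp: gaussian_cone.zero gaussian_cone_plus)

lemma gaussian_cone_iso_gaussian: "s > 0 \<Longrightarrow> gaussian_cone (iso_gaussian s \<mu>)"
  using gaussian_cone.add[OF gaussian_cone.zero, of 1 s \<mu>] by simp

lemma gaussian_cone_nonneg: "gaussian_cone h \<Longrightarrow> 0 \<le> h z"
  by (induction rule: gaussian_cone.induct) (auto simp: iso_gaussian_nonneg)

lemma gaussian_cone_continuous: "gaussian_cone h \<Longrightarrow> continuous_on A h"
  by (induction rule: gaussian_cone.induct) (auto intro!: continuous_intros continuous_iso_gaussian)

lemma gaussian_cone_integrable: "gaussian_cone h \<Longrightarrow> integrable lborel h"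
  by (induction rule: gaussian_cone.induct) (auto intro!: integrable_iso_gaussian)

text \<open>Rule induction gives the closure properties without index bookkeeping; indices return
  only here, in the form that \<open>gaussian_mixture\<close> expects. Weights stay strictly
  positive because the rule \<open>add\<close> admits no others and a factor 0 collapses to
  \<open>zero\<close>.\<close>

lemma gaussian_cone_representation:
  assumes "gaussian_cone h"
  shows "\<exists>K w \<mu> s. (\<forall>i\<in>{1..K::nat}. w i > 0 \<and> s i > 0) \<and>
           (\<forall>z. h z = (\<Sum>i=1..K. w i * iso_gaussian (s i) (\<mu> i) z))"
  using assms
proof induction
  case zero
  then show ?case
    by (intro exI[of _ 0]) auto
next
  case (add h w' s' \<mu>')
  then obtain K w \<mu> s where
    pos: "\<forall>i\<in>{1..K::nat}. w i > 0 \<and> s i > 0" and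
    h: "\<And>z. h z = (\<Sum>i=1..K. w i * iso_gaussian (s i) (\<mu> i) z)"
    by blast
  have "h z + w' * iso_gaussian s' \<mu>' z =
      (\<Sum>i=1..Suc K. (w(Suc K := w')) i * iso_gaussian ((s(Suc K := s')) i) ((\<mu>(Suc K := \<mu>')) i) z)" for z
    by (simp add: h)
  moreover have "\<forall>i\<in>{1..Suc K}. (w(Suc K := w')) i > 0 \<and> (s(Suc K := s')) i > 0"
    using pos add.hyps by (auto simp: le_Suc_eq)
  ultimately show ?case
    by blast
qed

text \<open>As a function of its mean the density is again a Gaussian, so continuity and
  measurability carry over to the variable of convolution.\<close>

lemma iso_gaussian_commute: "s > 0 \<Longrightarrow> iso_gaussian s \<mu> z = iso_gaussian s z \<mu>"
  by (simp add: iso_gaussian_eq std_gaussian_eq norm_minus_commute)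

section \<open>Approximation in the mean\<close>

lemma tagged_division_in_balls:
  fixes a b :: "'a::euclidean_space"
  assumes "r > 0"
  obtains p where "p tagged_division_of cbox a b" "\<And>x k. (x, k) \<in> p \<Longrightarrow> k \<subseteq> ball x r"
proof -
  have "gauge (\<lambda>x::'a. ball x r)"
    by (rule gauge_ball[OF assms])
  then obtain p where "p tagged_division_of cbox a b" "(\<lambda>x. ball x r) fine p"
    by (rule fine_division_exists)
  then show thesis
    by (intro that) (auto simp: fine_def)
qed

lemma integrable_lborel_cbox_indicator: "integrable lborel (indicator (cbox a b) :: 'a::euclidean_space \<Rightarrow> real)"
  by (intro integrable_real_indicator emeasure_bounded_finite) auto

text \<open>\<open>h\<close> is the Riemann sum over the mean: tags become means and contents become
  weights. Since each Gaussian has mass 1, the mass of \<open>h\<close> is exactly the content of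
  the box, however coarse the division.\<close>

lemma box_convolution_Riemann_sum:
  fixes a b :: "real^'m"
  assumes "s > 0" "e > 0"
  shows "\<exists>h. gaussian_cone h \<and> (\<integral>z. h z \<partial>lborel) = content (cbox a b) \<and>
    (\<forall>z. \<bar>h z - (\<integral>\<mu>. indicator (cbox a b) \<mu> * iso_gaussian s \<mu> z \<partial>lborel)\<bar> \<le> e)"
proof -
  obtain L where "L > 0" and L: "\<And>\<mu> \<nu> z. \<bar>iso_gaussian s \<mu> z - iso_gaussian s \<nu> (z :: real^'m)\<bar> \<le> L * dist \<mu> \<nu>"
    using iso_gaussian_Lipschitz[OF \<open>s > 0\<close>] by blast
  \<comment> \<open>\<open>r\<close> is the error allowed per unit volume. Pieces within radius
    \<open>r / L\<close> of their tags keep the change of the density below it.\<close>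
  define r where "r = e / (content (cbox a b) + 1)"
  have "r > 0"
    unfolding r_def by (rule mult_divide_add_one_less(1)[OF content_pos_le \<open>e > 0\<close>])
  then have "r / L > 0"
    using \<open>L > 0\<close> by simp
  obtain p where p: "p tagged_division_of cbox a b" and pr: "\<And>x k. (x, k) \<in> p \<Longrightarrow> k \<subseteq> ball x (r / L)"
    by (fact tagged_division_in_balls[OF \<open>r / L > 0\<close>])
  define h where "h = (\<lambda>z. \<Sum>u\<in>p. content (snd u) * iso_gaussian s (fst u) z)"
  have "gaussian_cone h"
    unfolding h_def using p \<open>s > 0\<close>
    by (intro gaussian_cone_sum gaussian_cone_mult gaussian_cone_iso_gaussian) auto
  moreover have "(\<integral>z. h z \<partial>lborel) = (\<Sum>u\<in>p. content (snd u))"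
    unfolding h_def using \<open>s > 0\<close>
    by (subst Bochner_Integration.integral_sum) (auto simp: integrable_iso_gaussian integral_iso_gaussian)
  then have "(\<integral>z. h z \<partial>lborel) = content (cbox a b)"
    using additive_content_tagged_division[OF p] by (simp add: case_prod_unfold)
  moreover have "\<bar>h z - (\<integral>\<mu>. indicator (cbox a b) \<mu> * iso_gaussian s \<mu> z \<partial>lborel)\<bar> \<le> e" for z
  proof -
    let ?g = "\<lambda>\<mu>. iso_gaussian s \<mu> z"
    have g: "?g = iso_gaussian s z"
      using \<open>s > 0\<close> by (auto intro: iso_gaussian_commute)
    have cont: "continuous_on A ?g" for A
      unfolding g by (rule continuous_iso_gaussian)
    have [measurable]: "?g \<in> borel_measurable borel"
      unfolding g by (rule borel_measurable_iso_gaussian)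
    have "(\<integral>\<mu>. indicator (cbox a b) \<mu> * ?g \<mu> \<partial>lborel) = integral (cbox a b) ?g"
      using set_lebesgue_integral_eq_integral(2)[OF absolutely_integrable_continuous[OF cont]]
      by (simp add: set_lebesgue_integral_def integral_completion)
    also have "\<dots> = (\<Sum>(x, k)\<in>p. integral k ?g)"
      using cont p by (intro integral_combine_tagged_division_topdown integrable_continuous)
    finally have "\<bar>h z - (\<integral>\<mu>. indicator (cbox a b) \<mu> * ?g \<mu> \<partial>lborel)\<bar> =
        \<bar>\<Sum>(x, k)\<in>p. content k * ?g x - integral k ?g\<bar>"
      by (simp add: h_def sum_subtractf case_prod_unfold)
    also have "\<dots> \<le> (\<Sum>(x, k)\<in>p. \<bar>content k * ?g x - integral k ?g\<bar>)"
      by (simp add: case_prod_unfold sum_abs)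
    also have "\<dots> \<le> (\<Sum>(x, k)\<in>p. content k * r)"
    proof (intro sum_mono, clarify)
      fix x k assume xk: "(x, k) \<in> p"
      obtain c d where k: "k = cbox c d"
        using tagged_division_ofD(4)[OF p xk] by (elim exE)
      have int: "((\<lambda>\<mu>. ?g \<mu> - ?g x) has_integral (integral k ?g - content k * ?g x)) (cbox c d)"
        using has_integral_diff[OF integrable_integral[OF integrable_continuous[OF cont]] has_integral_const[of "?g x" c d]]
        by (simp add: k)
      have "norm (?g \<mu> - ?g x) \<le> r" if "\<mu> \<in> cbox c d" for \<mu>
      proof -
        have "dist \<mu> x \<le> r / L"
          using pr[OF xk] that k by (auto simp: dist_commute less_imp_le)
        then have "L * dist \<mu> x \<le> r"
          using \<open>L > 0\<close> by (simp add: field_simps)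
        then show ?thesis
          using L[of \<mu> z x] by simp
      qed
      then have "norm (integral k ?g - content k * ?g x) \<le> r * content (cbox c d)"
        using \<open>r > 0\<close> by (intro has_integral_bound[OF _ int]) auto
      then show "\<bar>content k * ?g x - integral k ?g\<bar> \<le> content k * r"
        by (simp add: k abs_minus_commute mult.commute)
    qed
    also have "\<dots> = content (cbox a b) * r"
      using additive_content_tagged_division[OF p] by (simp add: case_prod_unfold flip: sum_distrib_right)
    also have "\<dots> \<le> e"
      unfolding r_def by (rule less_imp_le[OF mult_divide_add_one_less(2)[OF content_pos_le \<open>e > 0\<close>]])
    finally show ?thesis .
  qed
  ultimately show ?thesis
    by blast
qed

text \<open>Scheffe's lemma upgrades the pointwise convergence off the boundary of the box to
  convergence in the mean, since the approximants have the same total mass as the box.\<close>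

lemma box_indicator_approximation:
  fixes a b :: "real^'m"
  assumes "e > 0"
  shows "\<exists>h. gaussian_cone h \<and> (\<integral>z. \<bar>indicator (cbox a b) z - h z\<bar> \<partial>lborel) < e"
proof -
  \<comment> \<open>The sequence \<open>1 / (n + 1)\<close> serves both as standard deviation and as
    uniform error of the Riemann sum, so both vanish together.\<close>
  let ?c = "\<lambda>n z. \<integral>\<mu>. indicator (cbox a b) \<mu> * iso_gaussian (1 / real (Suc n)) \<mu> z \<partial>lborel"
  have ex: "\<forall>n. \<exists>h. gaussian_cone h \<and> (\<integral>z. h z \<partial>lborel) = content (cbox a b) \<and>
      (\<forall>z. \<bar>h z - ?c n z\<bar> \<le> 1 / real (Suc n))"
    by (intro allI box_convolution_Riemann_sum) auto
  obtain h where h: "\<forall>n. gaussian_cone (h n) \<and> (\<integral>z. h n z \<partial>lborel) = content (cbox a b) \<and>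
      (\<forall>z. \<bar>h n z - ?c n z\<bar> \<le> 1 / real (Suc n))"
    using choice[OF ex] by (rule exE)
  have cone: "gaussian_cone (h n)" and mass: "(\<integral>z. h n z \<partial>lborel) = content (cbox a b)"
    and close: "\<bar>h n z - ?c n z\<bar> \<le> 1 / real (Suc n)" for n z
    using h[THEN spec, of n] by auto
  have int: "integrable lborel (h n)" for n
    by (rule gaussian_cone_integrable[OF cone])
  have intd: "integrable lborel (\<lambda>z. \<bar>h n z - indicator (cbox a b) z\<bar>)" for n
    by (intro integrable_abs Bochner_Integration.integrable_diff int integrable_lborel_cbox_indicator)
  have inv: "(\<lambda>n. 1 / real (Suc n)) \<longlonglongrightarrow> 0"
    by (rule LIMSEQ_Suc[OF lim_1_over_n])
  have lim: "(\<lambda>n. h n z) \<longlonglongrightarrow> indicator (cbox a b) z" if "z \<notin> frontier (cbox a b)" for z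
  proof -
    have "(\<lambda>n. ?c n z) \<longlonglongrightarrow> indicator (cbox a b) z"
      by (rule tendsto_indicator_convolution[OF _ that inv]) auto
    moreover have "(\<lambda>n. h n z - ?c n z) \<longlonglongrightarrow> 0"
      by (rule Lim_null_comparison[OF _ inv]) (use close in simp)
    ultimately have "(\<lambda>n. (h n z - ?c n z) + ?c n z) \<longlonglongrightarrow> 0 + indicator (cbox a b) z"
      by (intro tendsto_add)
    then show ?thesis
      by simp
  qed
  \<comment> \<open>Convergence can fail only on the frontier of the box, which is negligible
    because the box is convex.\<close>
  have "AE z in lebesgue. (\<lambda>n. h n z) \<longlonglongrightarrow> indicator (cbox a b) z"
    unfolding eventually_ae_filter_negligible
    using lim negligible_convex_frontier[OF convex_box(1)] by blast
  then have "AE z in lborel. (\<lambda>n. h n z) \<longlonglongrightarrow> indicator (cbox a b) z"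
    by (simp only: AE_completion_iff)
  moreover have "(\<integral>\<^sup>+z. norm (h n z) \<partial>lborel) \<le> (\<integral>\<^sup>+z. norm (indicator (cbox a b) z :: real) \<partial>lborel)" for n
    using nn_integral_eq_integral[OF int] nn_integral_eq_integral[OF integrable_lborel_cbox_indicator[of a b]]
    by (simp add: gaussian_cone_nonneg[OF cone] mass)
  ultimately have "(\<lambda>n. \<integral>\<^sup>+z. norm (h n z - indicator (cbox a b) z) \<partial>lborel) \<longlonglongrightarrow> 0"
    using int integrable_lborel_cbox_indicator by (intro Scheffe_lemma2) auto
  then have "eventually (\<lambda>n. (\<integral>\<^sup>+z. norm (h n z - indicator (cbox a b) z) \<partial>lborel) < ennreal e) sequentially"
    using assms by (intro order_tendstoD(2)) auto
  then obtain n where "(\<integral>\<^sup>+z. norm (h n z - indicator (cbox a b) z) \<partial>lborel) < ennreal e"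
    by (meson eventually_happens sequentially_bot)
  also have "(\<integral>\<^sup>+z. norm (h n z - indicator (cbox a b) z) \<partial>lborel) =
      ennreal (\<integral>z. \<bar>h n z - indicator (cbox a b) z\<bar> \<partial>lborel)"
    using intd by (subst nn_integral_eq_integral) auto
  finally have "(\<integral>z. \<bar>indicator (cbox a b) z - h n z\<bar> \<partial>lborel) < e"
    using assms by (simp add: ennreal_less_iff abs_minus_commute)
  then show ?thesis
    using cone by blast
qed

text \<open>The pieces cover the box and have the same total volume, so their overlaps are null.\<close>

lemma AE_indicator_tagged_division:
  fixes a b :: "'a::euclidean_space"
  assumes p: "p tagged_division_of cbox a b"
  shows "AE z in lborel. (\<Sum>u\<in>p. indicator (snd u) z) = (indicator (cbox a b) z :: real)"
proof -
  \<comment> \<open>On the box \<open>?d\<close> counts the surplus pieces containing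
    \<open>z\<close>; it is non-negative with integral zero.\<close>
  let ?d = "\<lambda>z. (\<Sum>u\<in>p. indicator (snd u) z) - indicator (cbox a b) z :: real"
  have int: "integrable lborel (indicator (snd u) :: 'a \<Rightarrow> real)" if "u \<in> p" for u
    using tagged_division_ofD(4)[OF p, of "fst u" "snd u"] that integrable_lborel_cbox_indicator by auto
  have "indicator (cbox a b) z \<le> (\<Sum>u\<in>p. indicator (snd u) z :: real)" for z
  proof (cases "z \<in> cbox a b")
    case True
    then obtain u where "u \<in> p" "z \<in> snd u"
      using tagged_division_ofD(6)[OF p] by fastforce
    then show ?thesis
      using member_le_sum[of u p "\<lambda>u. indicator (snd u) z :: real"] p True by auto
  qed (simp add: sum_nonneg)
  then have nonneg: "0 \<le> ?d z" for z
    by simp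
  have int_d: "integrable lborel ?d"
    by (intro Bochner_Integration.integrable_diff Bochner_Integration.integrable_sum int
        integrable_lborel_cbox_indicator)
  have "(\<integral>z. ?d z \<partial>lborel) = (\<Sum>u\<in>p. content (snd u)) - content (cbox a b)"
    using int integrable_lborel_cbox_indicator
    by (subst Bochner_Integration.integral_diff) (auto simp: Bochner_Integration.integral_sum)
  also have "\<dots> = 0"
    using additive_content_tagged_division[OF p] by (simp add: case_prod_unfold)
  finally have "AE z in lborel. ?d z = 0"
    using integral_nonneg_eq_0_iff_AE[OF int_d] nonneg by simp
  then show ?thesis
    by simp
qed

text \<open>Each third of \<open>e\<close> pays for one error: the mass of \<open>f\<close> outside
  a large box, the deviation of \<open>f\<close> from its tag values, and the replacement of
  indicators of pieces by Gaussian combinations.\<close>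

lemma Riemann_gaussian_cone_approximation:
  fixes f :: "real^'m \<Rightarrow> real"
  assumes nonneg: "\<And>z. 0 \<le> f z" and int: "integrable lebesgue f"
    and osc: "\<And>a b. small_oscillation f a b" and "e > 0"
  shows "\<exists>h. gaussian_cone h \<and> (\<integral>z. \<bar>f z - h z\<bar> \<partial>lebesgue) < e"
proof -
  have "e / 3 > 0"
    using \<open>e > 0\<close> by simp
  obtain B where B: "\<forall>a b. ball 0 B \<subseteq> cbox a b \<longrightarrow>
      norm (integral (cbox a b) (\<lambda>z. if z \<in> UNIV then f z else 0) - (\<integral>z. f z \<partial>lebesgue)) < e / 3"
    using has_integral_integral_lebesgue[OF int, unfolded has_integral_alt', THEN conjunct2, THEN spec, THEN mp,
        OF \<open>e / 3 > 0\<close>]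
    by (elim exE conjE)
  obtain a where a: "ball 0 B \<subseteq> cbox (- a) (a :: real^'m)"
    using bounded_subset_cbox_symmetric[OF bounded_ball] by blast
  let ?Q = "cbox (- a) a"
  have "\<bar>integral ?Q f - (\<integral>z. f z \<partial>lebesgue)\<bar> < e / 3"
    using B[rule_format, OF a] by simp
  then have mass_Q: "(\<integral>z. f z \<partial>lebesgue) - integral ?Q f < e / 3"
    unfolding abs_less_iff by simp
  have abs_int: "f absolutely_integrable_on S" if "S \<in> sets lebesgue" for S
    using int that unfolding set_integrable_def by (rule integrable_mult_indicator[rotated])
  obtain d where "d > 0" and d: "\<And>p y. p tagged_division_of ?Q \<Longrightarrow>
      \<forall>(x, k)\<in>p. diameter k < d \<and> y (x, k) \<in> k \<Longrightarrow>
      (\<Sum>(x, k)\<in>p. content k * \<bar>f x - f (y (x, k))\<bar>) < e / 3"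
    by (fact small_oscillationE[OF osc \<open>e / 3 > 0\<close>])
  have "d / 3 > 0"
    using \<open>d > 0\<close> by simp
  obtain p where p: "p tagged_division_of ?Q" and pd: "\<And>x k. (x, k) \<in> p \<Longrightarrow> k \<subseteq> ball x (d / 3)"
    by (fact tagged_division_in_balls[OF \<open>d / 3 > 0\<close>])
  have "finite p"
    using p by blast
  have pieces: "\<exists>c d. snd u = cbox c d" if "u \<in> p" for u
    using tagged_division_ofD(4)[OF p, of "fst u" "snd u"] that by simp
  have "(\<Sum>(x, k)\<in>p. integral k (\<lambda>z. \<bar>f z - f x\<bar>)) \<le> e / 3"
  proof (rule oscillation_bounds_integral[OF abs_int p])
    fix y :: "(real^'m) \<times> (real^'m) set \<Rightarrow> real^'m"
    assume "\<forall>(x, k)\<in>p. y (x, k) \<in> k"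
    then show "(\<Sum>(x, k)\<in>p. content k * \<bar>f x - f (y (x, k))\<bar>) < e / 3"
      using diameter_less_of_subset_ball[OF pd \<open>d > 0\<close>] by (intro d[OF p]) auto
  qed simp
  then have osc_p: "(\<Sum>u\<in>p. integral (snd u) (\<lambda>z. \<bar>f z - f (fst u)\<bar>)) \<le> e / 3"
    by (simp add: case_prod_unfold)
  \<comment> \<open>The indicator of a piece is weighted by the value of \<open>f\<close> at its
    tag. The division is already fixed, so \<open>\<eta>\<close> may depend on the sum of these
    values.\<close>
  define \<eta> where "\<eta> = e / 3 / ((\<Sum>u\<in>p. f (fst u)) + 1)"
  have sum_nn: "0 \<le> (\<Sum>u\<in>p. f (fst u))"
    by (intro sum_nonneg nonneg)
  have "\<eta> > 0"
    unfolding \<eta>_def by (rule mult_divide_add_one_less(1)[OF sum_nn \<open>e / 3 > 0\<close>])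
  have ex: "\<forall>u\<in>p. \<exists>h. gaussian_cone h \<and> (\<integral>z. \<bar>indicator (snd u) z - h z\<bar> \<partial>lborel) < \<eta>"
  proof
    fix u assume "u \<in> p"
    then obtain c d where "snd u = cbox c d"
      using pieces by blast
    then show "\<exists>h. gaussian_cone h \<and> (\<integral>z. \<bar>indicator (snd u) z - h z\<bar> \<partial>lborel) < \<eta>"
      using box_indicator_approximation[OF \<open>\<eta> > 0\<close>, of c d] by simp
  qed
  obtain g where g_all: "\<forall>u\<in>p. gaussian_cone (g u) \<and> (\<integral>z. \<bar>indicator (snd u) z - g u z\<bar> \<partial>lborel) < \<eta>"
    using bchoice[OF ex] by (rule exE)
  have cone: "gaussian_cone (g u)" and g: "(\<integral>z. \<bar>indicator (snd u) z - g u z\<bar> \<partial>lborel) < \<eta>"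
    if "u \<in> p" for u
    using g_all that by auto
  define h where "h = (\<lambda>z. \<Sum>u\<in>p. f (fst u) * g u z)"
  have h: "gaussian_cone h"
    unfolding h_def using \<open>finite p\<close> cone nonneg by (intro gaussian_cone_sum gaussian_cone_mult)

  \<comment> \<open>\<open>?A\<close>, \<open>?B\<close> and \<open>?C\<close> are the three errors;
    \<open>?A\<close> equals its own absolute value because \<open>f\<close> is
    non-negative.\<close>
  let ?A = "\<lambda>z. f z - indicator ?Q z * f z"
  let ?B = "\<lambda>u z. indicator (snd u) z * \<bar>f z - f (fst u)\<bar>"
  let ?C = "\<lambda>u z. \<bar>indicator (snd u) z - g u z\<bar>"
  have gint: "integrable lebesgue (g u)" "integrable lborel (g u)" if "u \<in> p" for u
    using gaussian_cone_integrable[OF cone[OF that]] by (auto simp: integrable_completion)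
  have hint: "integrable lebesgue h"
    using gaussian_cone_integrable[OF h] by (auto simp: integrable_completion)
  have ind: "integrable lebesgue (indicator (snd u) :: _ \<Rightarrow> real)" if "u \<in> p" for u
    using pieces[OF that] integrable_lborel_cbox_indicator by (auto simp: integrable_completion)
  have Aint: "integrable lebesgue ?A"
    using int abs_int[of ?Q] unfolding set_integrable_def by auto
  have Bset: "(\<lambda>z. \<bar>f z - f (fst u)\<bar>) absolutely_integrable_on snd u" if u: "u \<in> p" for u
  proof -
    obtain c d where "snd u = cbox c d"
      using pieces[OF u] by blast
    then have "(\<lambda>z. f z - f (fst u)) absolutely_integrable_on snd u"
      by (intro set_integral_diff abs_int) (auto intro: absolutely_integrable_on_const)
    then show ?thesis
      by (rule set_integrable_abs)
  qed
  then have Bint: "integrable lebesgue (?B u)" if "u \<in> p" for u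
    using that unfolding set_integrable_def by simp
  have Cint: "integrable lebesgue (?C u)" if "u \<in> p" for u
    using ind[OF that] gint[OF that] by auto
  \<comment> \<open>Points on shared faces are counted more than once, so the pointwise estimate is
    asserted almost everywhere.\<close>
  have "AE z in lebesgue. (\<Sum>u\<in>p. indicator (snd u) z) = (indicator ?Q z :: real)"
    using AE_indicator_tagged_division[OF p] by (simp only: AE_completion_iff)
  then have "AE z in lebesgue. \<bar>f z - h z\<bar> \<le> ?A z + (\<Sum>u\<in>p. ?B u z) + (\<Sum>u\<in>p. f (fst u) * ?C u z)"
  proof eventually_elim
    case (elim z)
    have A: "\<bar>?A z\<bar> = ?A z"
      using nonneg[of z] by (simp add: indicator_def)
    have "indicator ?Q z * f z - h z = (\<Sum>u\<in>p. indicator (snd u) z * f z - f (fst u) * g u z)"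
      by (simp add: h_def sum_subtractf sum_distrib_right flip: elim)
    also have "\<dots> = (\<Sum>u\<in>p. indicator (snd u) z * (f z - f (fst u)) +
        f (fst u) * (indicator (snd u) z - g u z))"
      by (rule sum.cong) (auto simp: algebra_simps)
    also have "\<bar>\<dots>\<bar> \<le> (\<Sum>u\<in>p. \<bar>indicator (snd u) z * (f z - f (fst u)) +
        f (fst u) * (indicator (snd u) z - g u z)\<bar>)"
      by (rule sum_abs)
    also have "\<dots> \<le> (\<Sum>u\<in>p. ?B u z + f (fst u) * ?C u z)"
    proof (rule sum_mono)
      fix u
      show "\<bar>indicator (snd u) z * (f z - f (fst u)) + f (fst u) * (indicator (snd u) z - g u z)\<bar>
          \<le> ?B u z + f (fst u) * ?C u z"
        by (rule order_trans[OF abs_triangle_ineq]) (simp add: abs_mult nonneg)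
    qed
    finally have "\<bar>indicator ?Q z * f z - h z\<bar> \<le> (\<Sum>u\<in>p. ?B u z) + (\<Sum>u\<in>p. f (fst u) * ?C u z)"
      by (simp add: sum.distrib)
    then show ?case
      using A by linarith
  qed
  then have "(\<integral>z. \<bar>f z - h z\<bar> \<partial>lebesgue) \<le>
      (\<integral>z. ?A z + (\<Sum>u\<in>p. ?B u z) + (\<Sum>u\<in>p. f (fst u) * ?C u z) \<partial>lebesgue)"
    using int hint Aint Bint Cint by (intro integral_mono_AE) auto
  also have "\<dots> = (\<integral>z. ?A z \<partial>lebesgue) + (\<Sum>u\<in>p. \<integral>z. ?B u z \<partial>lebesgue) +
      (\<Sum>u\<in>p. f (fst u) * (\<integral>z. ?C u z \<partial>lebesgue))"
    using Aint Bint Cint by (simp add: Bochner_Integration.integral_sum)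
  also have "(\<integral>z. ?A z \<partial>lebesgue) = (\<integral>z. f z \<partial>lebesgue) - integral ?Q f"
    using int abs_int[of ?Q] set_lebesgue_integral_eq_integral(2)[OF abs_int[of ?Q]]
    unfolding set_integrable_def set_lebesgue_integral_def by simp
  also have "\<dots> < e / 3"
    using mass_Q by linarith
  also have "(\<Sum>u\<in>p. \<integral>z. ?B u z \<partial>lebesgue) = (\<Sum>u\<in>p. integral (snd u) (\<lambda>z. \<bar>f z - f (fst u)\<bar>))"
    using set_lebesgue_integral_eq_integral(2)[OF Bset]
    unfolding set_lebesgue_integral_def by (intro sum.cong) auto
  also note osc_p
  also have "(\<Sum>u\<in>p. f (fst u) * (\<integral>z. ?C u z \<partial>lebesgue)) \<le> (\<Sum>u\<in>p. f (fst u) * \<eta>)"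
  proof (intro sum_mono mult_left_mono nonneg)
    fix u assume u: "u \<in> p"
    \<comment> \<open>\<open>f\<close> does not occur in \<open>?C\<close>, so this integrand is
      Borel and completing the measure leaves its integral unchanged.\<close>
    have "(\<integral>z. ?C u z \<partial>lebesgue) = (\<integral>z. ?C u z \<partial>lborel)"
      using gint(2)[OF u] pieces[OF u] by (intro integral_completion) auto
    then show "(\<integral>z. ?C u z \<partial>lebesgue) \<le> \<eta>"
      using g[OF u] by simp
  qed
  also have "(\<Sum>u\<in>p. f (fst u) * \<eta>) = (\<Sum>u\<in>p. f (fst u)) * \<eta>"
    by (simp add: sum_distrib_right)
  also have "\<dots> < e / 3"
    unfolding \<eta>_def by (rule mult_divide_add_one_less(2)[OF sum_nn \<open>e / 3 > 0\<close>])
  finally show ?thesis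
    using h by auto
qed

section \<open>Normalising the combination to a mixture\<close>

theorem theorem3:
  fixes f :: "real^'m \<Rightarrow> real" and \<delta> q :: real
  assumes "\<And>z. 0 \<le> f z"
    and "has_improper_Riemann_integral f 1"
    and "\<delta> > 0" and "q \<ge> 1"
  shows "\<exists>(K::nat) (w :: nat \<Rightarrow> real) (\<mu> :: nat \<Rightarrow> real^'m) (S :: nat \<Rightarrow> real^'m^'m).
           mixture_parameters K w S \<and>
           (\<forall>i\<in>{1..K}. max_eigenvalue (S i) / min_eigenvalue (S i) \<le> q) \<and>
           (\<exists>J. has_improper_Riemann_integral (\<lambda>z. \<bar>f z - gaussian_mixture K w \<mu> S z\<bar>) J \<and> J < \<delta>)"
proof -
  have f1: "(f has_integral 1) UNIV"
    using assms(2) by (rule has_improper_Riemann_integral_imp_has_integral)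
  then have "f absolutely_integrable_on UNIV"
    using assms(1) by (intro nonnegative_absolutely_integrable_1) auto
  then have fint: "integrable lebesgue f"
    by (simp add: set_integrable_def)
  have mass_f: "(\<integral>z. f z \<partial>lebesgue) = 1"
    using has_integral_integral_lebesgue[OF fint] f1 by (rule has_integral_unique)
  have osc: "small_oscillation f a b" for a b
  proof -
    obtain J where "has_Riemann_integral_box f J a b"
      using assms(2)[unfolded has_improper_Riemann_integral_def, THEN conjunct1, THEN spec, THEN spec] by (rule exE)
    then show ?thesis
      by (rule has_Riemann_integral_box_imp_small_oscillation)
  qed
  \<comment> \<open>Approximation and normalisation each cost less than \<open>\<epsilon>\<close>,
    hence \<open>\<delta> / 2\<close>. The cap 1 forces \<open>|1 - W| < 1\<close>, so that
    \<open>W\<close> is positive and can be divided by.\<close>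
  define \<epsilon> where "\<epsilon> = min (\<delta> / 2) 1"
  have "\<epsilon> > 0"
    using \<open>\<delta> > 0\<close> by (simp add: \<epsilon>_def)
  obtain h where cone: "gaussian_cone h" and h: "(\<integral>z. \<bar>f z - h z\<bar> \<partial>lebesgue) < \<epsilon>"
    using Riemann_gaussian_cone_approximation[OF assms(1) fint osc \<open>\<epsilon> > 0\<close>] by blast
  define W where "W = (\<integral>z. h z \<partial>lborel)"
  have hborel: "integrable lborel h"
    by (rule gaussian_cone_integrable[OF cone])
  then have hint: "integrable lebesgue h" and W: "(\<integral>z. h z \<partial>lebesgue) = W"
    by (auto simp: integrable_completion integral_completion W_def)
  have "\<bar>1 - W\<bar> = \<bar>\<integral>z. f z - h z \<partial>lebesgue\<bar>"
    using fint hint by (simp add: mass_f W)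
  also have "\<dots> \<le> (\<integral>z. \<bar>f z - h z\<bar> \<partial>lebesgue)"
    by (rule integral_abs_bound)
  finally have W1: "\<bar>1 - W\<bar> < \<epsilon>"
    using h by simp
  then have "\<bar>1 - W\<bar> < 1"
    by (simp add: \<epsilon>_def)
  then have "W > 0"
    by linarith
  obtain K w \<mu> s where pos: "\<And>i. i \<in> {1..K::nat} \<Longrightarrow> w i > 0 \<and> s i > 0"
    and h_eq: "\<And>z. h z = (\<Sum>i=1..K. w i * iso_gaussian (s i) (\<mu> i) z)"
    using gaussian_cone_representation[OF cone] by blast
  have W_eq: "W = (\<Sum>i=1..K. w i)"
    unfolding W_def h_eq using pos
    by (subst Bochner_Integration.integral_sum) (auto simp: integrable_iso_gaussian integral_iso_gaussian)
  define S where "S = (\<lambda>i. mat ((s i)\<^sup>2) :: real^'m^'m)"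
  have mix: "gaussian_mixture K (\<lambda>i. w i / W) \<mu> S z = h z / W" for z
    by (simp add: gaussian_mixture_def S_def h_eq sum_divide_distrib)
  \<comment> \<open>The cone contains the zero function, represented by an empty sum; positive mass
    excludes it.\<close>
  have "K \<noteq> 0"
    using \<open>W > 0\<close> W_eq by (intro notI) simp
  then have "mixture_parameters K (\<lambda>i. w i / W) S"
    unfolding mixture_parameters_def
  proof (intro conjI ballI)
    show "(\<Sum>i=1..K. w i / W) = 1"
      using \<open>W > 0\<close> by (simp add: W_eq flip: sum_divide_distrib)
    fix i assume i: "i \<in> {1..K}"
    show "w i / W > 0" "covariance_matrix (S i)" "invertible (S i)"
      using pos[OF i] \<open>W > 0\<close> by (auto simp: S_def covariance_matrix_mat intro: invertible_mat)
  qed simp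
  moreover have "\<forall>i\<in>{1..K}. max_eigenvalue (S i) / min_eigenvalue (S i) \<le> q"
    using \<open>q \<ge> 1\<close> by (simp add: S_def max_eigenvalue_def min_eigenvalue_def eigenvalues_mat)
  moreover have "has_improper_Riemann_integral (\<lambda>z. \<bar>f z - h z / W\<bar>) (\<integral>z. \<bar>f z - h z / W\<bar> \<partial>lebesgue)"
  proof (rule has_improper_Riemann_integralI)
    have int: "integrable lebesgue (\<lambda>z. \<bar>f z - h z / W\<bar>)"
      using fint hint by auto
    show "((\<lambda>z. \<bar>f z - h z / W\<bar>) has_integral (\<integral>z. \<bar>f z - h z / W\<bar> \<partial>lebesgue)) UNIV"
      by (rule has_integral_integral_lebesgue[OF int])
    show "(\<lambda>z. \<bar>f z - h z / W\<bar>) absolutely_integrable_on UNIV"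
      using int by (simp add: set_integrable_def)
    show "small_oscillation (\<lambda>z. \<bar>f z - h z / W\<bar>) a b" for a b
      using \<open>W > 0\<close> by (intro small_oscillation_abs_diff osc continuous_imp_small_oscillation
          continuous_intros gaussian_cone_continuous[OF cone]) auto
  qed
  moreover have "(\<integral>z. \<bar>f z - h z / W\<bar> \<partial>lebesgue) < \<delta>"
  proof -
    \<comment> \<open>Rescaling changes \<open>h\<close> by \<open>|1 - W| / W * h\<close>, whose
      integral is exactly \<open>|1 - W|\<close>, and this is at most the distance in the mean
      between \<open>f\<close> and \<open>h\<close>.\<close>
    have "\<bar>f z - h z / W\<bar> \<le> \<bar>f z - h z\<bar> + \<bar>1 - W\<bar> / W * h z" for z
    proof -
      have "h z - h z / W = (W - 1) / W * h z"
        using \<open>W > 0\<close> by (simp add: field_simps)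
      then have "\<bar>h z - h z / W\<bar> = \<bar>1 - W\<bar> / W * h z"
        using \<open>W > 0\<close> gaussian_cone_nonneg[OF cone, of z] by (simp add: abs_mult abs_minus_commute)
      then show ?thesis
        by linarith
    qed
    then have "(\<integral>z. \<bar>f z - h z / W\<bar> \<partial>lebesgue) \<le> (\<integral>z. \<bar>f z - h z\<bar> + \<bar>1 - W\<bar> / W * h z \<partial>lebesgue)"
      using fint hint by (intro integral_mono) auto
    also have "\<dots> = (\<integral>z. \<bar>f z - h z\<bar> \<partial>lebesgue) + \<bar>1 - W\<bar>"
      using fint hint \<open>W > 0\<close> by (simp add: W)
    also have "\<dots> < \<epsilon> + \<epsilon>"
      using h W1 by (rule add_strict_mono)
    also have "\<dots> \<le> \<delta>"
      by (simp add: \<epsilon>_def)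
    finally show ?thesis .
  qed
  ultimately show ?thesis
    unfolding mix[symmetric] by blast
qed

end
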